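(* Let $\tau=e^{2\pi\mathbf i/3}$, let $\mathbb T$ be the directed triangular lattice, and let $\Phi:\mathbb T\to\mathbb R$. For $v\in\mathbb T$ and $i=0,1,2$ put $\alpha_i(v)=\Phi(v+\tau^i)-\Phi(v)$ and $a(v)=\sum_{i=0}^2e^{\alpha_i(v)}$, so that $\alpha(v)=\frac23\sum_{i=0}^2\alpha_i(v)\tau^i=\nabla^{\mathbb T}\Phi(v)$ derives from the potential $\Phi$. Let $\mathbb Q_x$ be the law of the Markov chain on $\mathbb T$ started at $x$ with $\mathbb Q(v,v+\tau^i)=e^{\alpha_i(v)}/a(v)$, $i=0,1,2$, and $\mathbb P_x$ the law of simple random walk on $\mathbb T$ (steps $1,\tau,\tau^2$ with probability $1/3$ each). Define $\beta(v)\ge0$ by $\exp(-\beta(v)^2)=(a(v)/3)^{-3}\prod_{i=0}^2e^{\alpha_i(v)}$. Then for every finite path $\gamma=(x_0,\dots,x_n)$ in $\mathbb T$ with $x_0=x$ and steps in $\{1,\tau,\tau^2\}$, $$\frac{\mathbb Q_x(\gamma)}{\mathbb P_x(\gamma)}=\exp\big(\Phi(x_n)-\Phi(x_0)-A_n\big),\qquad A_n=\sum_{s=0}^{n-1}\Big(\Delta^{\mathbb T}\Phi(x_s)+\frac13\beta^2(x_s)\Big),$$ where $\Delta^{\mathbb T}\Phi(x)=\frac13\sum_{i=0}^2\big(\Phi(x+\tau^i)-\Phi(x)\big)$.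
   Context: The directed triangular lattice $\mathbb T$ has vertex set $\{a+b\tau:a,b\in\mathbb Z\}$ and directed edges $v\to v+\tau^k$, $k=0,1,2$. The discrete gradient is $\nabla^{\mathbb T}\Phi(v)=\frac23\sum_{i=0}^2(\Phi(v+\tau^i)-\Phi(v))\tau^i$. For a law $\mathbb P_x$ of a chain $X$, $\mathbb P_x(\gamma)$ denotes the probability that $X_s=x_s$ for all $0\le s\le n$. *)

theory Defs
  imports "HOL-Probability.Probability"
begin

definition tau :: complex ("\<tau>") where
  "\<tau> = exp (2 * of_real pi * \<i> / 3)"

definition tri_verts :: "complex set" ("\<T>") where
  "\<T> = {of_int a + of_int b * \<tau> | a b :: int. True}"

definition tri_edge :: "complex \<Rightarrow> complex \<Rightarrow> bool" where
  "tri_edge v w \<longleftrightarrow> v \<in> \<T> \<and> w \<in> \<T> \<and> (\<exists>k<3::nat. w = v + \<tau> ^ k)"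

text \<open>
  A function on the lattice is a function on \<open>complex\<close>; everything below, evaluated at a
  vertex, only uses its values on \<open>\<T>\<close>.
\<close>

definition tri_alpha :: "(complex \<Rightarrow> real) \<Rightarrow> nat \<Rightarrow> complex \<Rightarrow> real" where
  "tri_alpha \<Phi> i v = \<Phi> (v + \<tau> ^ i) - \<Phi> v"

definition tri_grad :: "(complex \<Rightarrow> real) \<Rightarrow> complex \<Rightarrow> complex" where
  "tri_grad \<Phi> v = 2 / 3 * (\<Sum>i<3. of_real (\<Phi> (v + \<tau> ^ i) - \<Phi> v) * \<tau> ^ i)"

definition tri_laplace :: "(complex \<Rightarrow> real) \<Rightarrow> complex \<Rightarrow> real" where
  "tri_laplace \<Phi> v = 1 / 3 * (\<Sum>i<3. \<Phi> (v + \<tau> ^ i) - \<Phi> v)"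

definition tri_a :: "(complex \<Rightarrow> real) \<Rightarrow> complex \<Rightarrow> real" where
  "tri_a \<Phi> v = (\<Sum>i<3. exp (tri_alpha \<Phi> i v))"

definition tri_beta :: "(complex \<Rightarrow> real) \<Rightarrow> complex \<Rightarrow> real" where
  "tri_beta \<Phi> v = (THE b. 0 \<le> b \<and>
     exp (- b\<^sup>2) = (tri_a \<Phi> v / 3) powi (-3) * (\<Prod>i<3. exp (tri_alpha \<Phi> i v)))"

text \<open>
  Transition probabilities from \<open>v\<close> to \<open>w\<close>. The three targets \<open>v + \<tau> ^ i\<close> are distinct, so at
  most one summand is nonzero.
\<close>

definition drift_kernel :: "(complex \<Rightarrow> real) \<Rightarrow> complex \<Rightarrow> complex \<Rightarrow> real" where
  "drift_kernel \<Phi> v w =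
     (\<Sum>i<3. if w = v + \<tau> ^ i then exp (tri_alpha \<Phi> i v) / tri_a \<Phi> v else 0)"

definition srw_kernel :: "complex \<Rightarrow> complex \<Rightarrow> real" where
  "srw_kernel v w = (\<Sum>i<3. if w = v + \<tau> ^ i then 1 / 3 else 0)"

text \<open>
  \<open>markov_law S p x \<mu>\<close>: under the probability measure \<open>\<mu>\<close> on the trajectory space \<open>S\<^sup>\<nat>\<close>, with
  its product sigma-algebra, the coordinate process is a Markov chain started at \<open>x\<close> with
  transition probabilities \<open>p\<close>. The Markov property is required given every history of
  positive probability.
\<close>

definition markov_law ::
    "'s set \<Rightarrow> ('s \<Rightarrow> 's \<Rightarrow> real) \<Rightarrow> 's \<Rightarrow> (nat \<Rightarrow> 's) measure \<Rightarrow> bool" where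
  "markov_law S p x \<mu> \<longleftrightarrow>
     prob_space \<mu> \<and>
     sets \<mu> = sets (\<Pi>\<^sub>M n\<in>UNIV. count_space S) \<and>
     \<P>(X in \<mu>. X 0 = x) = 1 \<and>
     (\<forall>n y. \<forall>z\<in>S. \<P>(X in \<mu>. \<forall>s\<le>n. X s = y s) > 0 \<longrightarrow>
        \<P>(X in \<mu>. X (Suc n) = z \<bar> \<forall>s\<le>n. X s = y s) = p (y n) z)"

definition path_prob :: "(nat \<Rightarrow> 's) measure \<Rightarrow> nat \<Rightarrow> (nat \<Rightarrow> 's) \<Rightarrow> real" where
  "path_prob \<mu> n \<gamma> = \<P>(X in \<mu>. \<forall>s\<le>n. X s = \<gamma> s)"

text \<open>The laws exist, so hypotheses of the form \<open>markov_law S p x \<mu>\<close> are not vacuous.\<close>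

lemma markov_law_exists_pmf:
  fixes K :: "'s \<Rightarrow> 's pmf"
  assumes S: "countable S" and x: "x \<in> S" and K: "\<And>v. set_pmf (K v) \<subseteq> S"
  shows "\<exists>\<mu>. markov_law S (\<lambda>v w. pmf (K v) w) x \<mu>"
proof -
  define M where "M j = restrict_space (measure_pmf (K (snd j))) S" for j :: "nat \<times> 's"
  define I where "I = (UNIV :: nat set) \<times> S"
  define C where "C = count_space S"
  have sets_M[simp]: "sets (M j) = Pow S" for j
    by (auto simp: M_def sets_restrict_space)
  have space_M[simp]: "space (M j) = S" for j
    by (simp add: M_def space_restrict_space)
  have M1: "prob_space (M j)" for j
    unfolding M_def
    by (rule prob_space_restrict_space)
       (use K in \<open>auto simp: measure_pmf.emeasure_eq_measure measure_pmf.prob_eq_1 AE_measure_pmf_iff\<close>)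
  interpret product_prob_space M I
    using M1 by (auto simp: product_prob_space_def product_prob_space_axioms_def
        product_sigma_finite_def intro: prob_space_imp_sigma_finite)
  have M_single: "measure (M j) {z} = pmf (K (snd j)) z" if "z \<in> S" for j z
    using that by (simp add: M_def measure_restrict_space measure_pmf_single)
  define W where "W = PiM I M"
  define X where "X \<omega> n = rec_nat x (\<lambda>m v. \<omega> (m, v)) n" for \<omega> :: "nat \<times> 's \<Rightarrow> 's" and n
  have X0[simp]: "X \<omega> 0 = x" and XS[simp]: "X \<omega> (Suc n) = \<omega> (n, X \<omega> n)" for \<omega> n
    by (simp_all add: X_def)
  have X_meas: "(\<lambda>\<omega>. X \<omega> n) \<in> measurable W C" for n
  proof (induction n)
    case 0
    show ?case using x by (simp add: C_def)
  next
    case (Suc n)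
    have comp: "(\<lambda>\<omega>. \<omega> (n, v)) \<in> measurable W C" if "v \<in> S" for v
    proof -
      have "(\<lambda>\<omega>. \<omega> (n, v)) \<in> measurable W (M (n, v))"
        unfolding W_def by (rule measurable_component_singleton) (use that in \<open>simp add: I_def\<close>)
      also have "measurable W (M (n, v)) = measurable W C"
        by (rule measurable_cong_sets) (auto simp: C_def)
      finally show ?thesis .
    qed
    show ?case
      unfolding XS
      by (rule measurable_compose_countable'[where I = S, OF comp _ S]) (use Suc in \<open>simp_all add: C_def\<close>)
  qed
  have X_S: "X \<omega> n \<in> S" if "\<omega> \<in> space W" for \<omega> n
    using measurable_space[OF X_meas that] by (simp add: C_def)
  have X_PiM: "X \<in> measurable W (\<Pi>\<^sub>M n\<in>UNIV. C)"
  proof -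
    have "(\<lambda>\<omega> n. X \<omega> n) \<in> measurable W (\<Pi>\<^sub>M n\<in>UNIV. C)"
    proof (rule measurable_PiM_single')
      show "(\<lambda>\<omega>. X \<omega> n) \<in> measurable W C" for n by (rule X_meas)
      show "(\<lambda>\<omega> n. X \<omega> n) \<in> space W \<rightarrow> (\<Pi>\<^sub>E n\<in>UNIV. space C)"
        using X_S by (simp add: C_def Pi_iff PiE_iff)
    qed
    then show ?thesis by simp
  qed
  define \<mu> where "\<mu> = distr W (\<Pi>\<^sub>M n\<in>UNIV. C) X"
  have W1: "prob_space W" unfolding W_def by (rule prob_space_PiM) (rule M1)
  have \<mu>1: "prob_space \<mu>"
    unfolding \<mu>_def by (rule prob_space.prob_space_distr[OF W1 X_PiM])
  have sets_\<mu>: "sets \<mu> = sets (\<Pi>\<^sub>M n\<in>UNIV. C)"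
    by (simp add: \<mu>_def)
  have path_sets: "{f \<in> space (\<Pi>\<^sub>M n\<in>UNIV. C). \<forall>s\<le>n. f s = y s} \<in> sets (\<Pi>\<^sub>M n\<in>UNIV. C)" for n :: nat and y
  proof -
    have "(\<lambda>f. f s) -` ({y s} \<inter> S) \<inter> space (\<Pi>\<^sub>M n\<in>UNIV. C) \<in> sets (\<Pi>\<^sub>M n\<in>UNIV. C)" for s
      by (rule measurable_sets[OF measurable_component_singleton]) (auto simp: C_def)
    moreover have "(\<lambda>f. f s) -` ({y s} \<inter> S) \<inter> space (\<Pi>\<^sub>M n\<in>UNIV. C) =
        {f \<in> space (\<Pi>\<^sub>M n\<in>UNIV. C). f s = y s}" for s
      by (auto simp: space_PiM PiE_iff C_def)
    ultimately have *: "{f \<in> space (\<Pi>\<^sub>M n\<in>UNIV. C). f s = y s} \<in> sets (\<Pi>\<^sub>M n\<in>UNIV. C)" for s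
      by simp
    have "{f \<in> space (\<Pi>\<^sub>M n\<in>UNIV. C). \<forall>s\<in>{..n}. f s = y s} \<in> sets (\<Pi>\<^sub>M n\<in>UNIV. C)"
      by (rule sets.sets_Collect_finite_All[OF *]) simp
    then show ?thesis by (simp only: Ball_def atMost_iff)
  qed
  have push: "\<P>(f in \<mu>. \<forall>s\<le>n. f s = y s) = measure W {\<omega> \<in> space W. \<forall>s\<le>n. X \<omega> s = y s}" for n y
  proof -
    have "\<P>(f in \<mu>. \<forall>s\<le>n. f s = y s) =
        measure W (X -` {f \<in> space (\<Pi>\<^sub>M n\<in>UNIV. C). \<forall>s\<le>n. f s = y s} \<inter> space W)"
      unfolding \<mu>_def space_distr by (rule measure_distr[OF X_PiM path_sets])
    also have "X -` {f \<in> space (\<Pi>\<^sub>M n\<in>UNIV. C). \<forall>s\<le>n. f s = y s} \<inter> space W =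
        {\<omega> \<in> space W. \<forall>s\<le>n. X \<omega> s = y s}"
      using measurable_space[OF X_PiM] by auto
    finally show ?thesis .
  qed
  have path: "\<P>(f in \<mu>. \<forall>s\<le>n. f s = y s) = (\<Prod>s<n. pmf (K (y s)) (y (Suc s)))"
    if y0: "y 0 = x" and yS: "\<forall>s\<le>n. y s \<in> S" for n y
  proof -
    define J where "J = (\<lambda>s. (s, y s)) ` {..<n}"
    define E where "E j = {y (Suc (fst j))}" for j :: "nat \<times> 's"
    have "{\<omega> \<in> space W. \<forall>s\<le>n. X \<omega> s = y s} = {\<omega> \<in> space W. \<forall>s<n. \<omega> (s, y s) = y (Suc s)}"
    proof -
      have "(\<forall>s\<le>n. X \<omega> s = y s) \<longleftrightarrow> (\<forall>s<n. \<omega> (s, y s) = y (Suc s))" for \<omega>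
      proof
        assume *: "\<forall>s\<le>n. X \<omega> s = y s"
        show "\<forall>s<n. \<omega> (s, y s) = y (Suc s)"
        proof (intro allI impI)
          fix s assume "s < n"
          then have "X \<omega> (Suc s) = y (Suc s)" and "X \<omega> s = y s"
            using *[rule_format, of "Suc s"] *[rule_format, of s] by (simp_all del: XS)
          then show "\<omega> (s, y s) = y (Suc s)" by (metis XS)
        qed
      next
        assume *: "\<forall>s<n. \<omega> (s, y s) = y (Suc s)"
        have "s \<le> n \<longrightarrow> X \<omega> s = y s" for s
          by (induction s) (use * y0 in auto)
        then show "\<forall>s\<le>n. X \<omega> s = y s" by simp
      qed
      then show ?thesis by simp
    qed
    also have "\<dots> = prod_emb I M J (Pi\<^sub>E J E)"
      unfolding prod_emb_def W_def
      by (auto simp: J_def E_def PiE_iff space_PiM restrict_def extensional_def)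
    also have "measure W \<dots> = (\<Prod>j\<in>J. measure (M j) (E j))"
      unfolding W_def
      by (rule measure_PiM_emb) (use yS in \<open>auto simp: J_def I_def E_def\<close>)
    also have "\<dots> = (\<Prod>s<n. measure (M (s, y s)) (E (s, y s)))"
      unfolding J_def by (subst prod.reindex) (auto simp: inj_on_def)
    also have "\<dots> = (\<Prod>s<n. pmf (K (y s)) (y (Suc s)))"
      by (rule prod.cong) (use yS in \<open>auto simp: E_def M_single\<close>)
    finally show ?thesis unfolding push .
  qed
  have "markov_law S (\<lambda>v w. pmf (K v) w) x \<mu>"
    unfolding markov_law_def
  proof (intro conjI allI ballI impI)
    show "\<P>(f in \<mu>. f 0 = x) = 1"
      using path[of "\<lambda>_. x" 0] x by simp
  next
    fix n y z
    assume z: "z \<in> S" and pos: "\<P>(f in \<mu>. \<forall>s\<le>n. f s = y s) > 0"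
    have "{\<omega> \<in> space W. \<forall>s\<le>n. X \<omega> s = y s} \<noteq> {}"
      using pos unfolding push by (metis measure_empty less_irrefl)
    then obtain \<omega> where \<omega>: "\<omega> \<in> space W" and X_y: "\<forall>s\<le>n. X \<omega> s = y s" by blast
    have y0: "y 0 = x"
      using X_y[rule_format, of 0] by simp
    have yS: "\<forall>s\<le>n. y s \<in> S"
      using X_y X_S[OF \<omega>] by metis
    let ?y = "y(Suc n := z)"
    have "{f \<in> space \<mu>. f (Suc n) = z \<and> (\<forall>s\<le>n. f s = y s)} = {f \<in> space \<mu>. \<forall>s\<le>Suc n. f s = ?y s}"
      by (auto simp: le_Suc_eq)
    then have "\<P>(f in \<mu>. f (Suc n) = z \<and> (\<forall>s\<le>n. f s = y s)) =
        (\<Prod>s<Suc n. pmf (K (?y s)) (?y (Suc s)))"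
      using path[of ?y "Suc n"] y0 yS z by (simp add: le_Suc_eq)
    also have "\<dots> = (\<Prod>s<n. pmf (K (y s)) (y (Suc s))) * pmf (K (y n)) z"
      by simp
    finally have num: "\<P>(f in \<mu>. f (Suc n) = z \<and> (\<forall>s\<le>n. f s = y s)) =
        (\<Prod>s<n. pmf (K (y s)) (y (Suc s))) * pmf (K (y n)) z" .
    have nz: "(\<Prod>s<n. pmf (K (y s)) (y (Suc s))) \<noteq> 0"
      using pos unfolding path[OF y0 yS] by (rule less_imp_neq[symmetric])
    show "\<P>(f in \<mu>. f (Suc n) = z \<bar> \<forall>s\<le>n. f s = y s) = pmf (K (y n)) z"
      unfolding cond_prob_def num path[OF y0 yS] by (rule nonzero_mult_div_cancel_left[OF nz])
  qed (use \<mu>1 sets_\<mu> in \<open>simp_all add: C_def\<close>)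
  then show ?thesis ..
qed

lemma tau_pow3: "\<tau> ^ 3 = 1"
proof -
  have "\<tau> ^ 3 = exp (of_nat 3 * (2 * of_real pi * \<i> / 3))"
    by (simp only: tau_def exp_of_nat_mult)
  also have "of_nat 3 * (2 * of_real pi * \<i> / 3) = 2 * of_real pi * \<i>" by simp
  also have "exp \<dots> = 1" by (rule exp_two_pi_i)
  finally show ?thesis .
qed

lemma tau_sq: "\<tau> ^ 2 = - 1 - \<tau>"
proof -
  have "\<tau> \<noteq> 1"
  proof
    assume "\<tau> = 1"
    then have "Re \<tau> = 1" by simp
    then show False by (simp add: tau_def Re_exp cos_120)
  qed
  moreover have "(\<tau> - 1) * (\<tau> ^ 2 + \<tau> + 1) = 0"
    using tau_pow3 by (simp add: algebra_simps power2_eq_square power3_eq_cube)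
  ultimately have "\<tau> ^ 2 + \<tau> + 1 = 0" by simp
  then have "\<tau> ^ 2 + (1 + \<tau>) = 0" by (simp add: ac_simps)
  then have "\<tau> ^ 2 = - (1 + \<tau>)" by (simp only: eq_neg_iff_add_eq_0)
  then show ?thesis by simp
qed

lemma tri_verts_step:
  assumes "v \<in> \<T>" and "k < (3::nat)"
  shows "v + \<tau> ^ k \<in> \<T>"
proof -
  obtain a b :: int where v: "v = of_int a + of_int b * \<tau>"
    using assms(1) by (auto simp: tri_verts_def)
  have "k = 0 \<or> k = 1 \<or> k = 2" using assms(2) by auto
  then have "v + \<tau> ^ k = of_int (a + 1) + of_int b * \<tau> \<or> v + \<tau> ^ k = of_int a + of_int (b + 1) * \<tau> \<or>
      v + \<tau> ^ k = of_int (a - 1) + of_int (b - 1) * \<tau>"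
    by (auto simp: v tau_sq algebra_simps)
  then show ?thesis unfolding tri_verts_def by blast
qed

lemma countable_tri_verts: "countable \<T>"
proof -
  have "\<T> = (\<lambda>(a, b). of_int a + of_int b * \<tau>) ` (UNIV :: (int \<times> int) set)"
    by (auto simp: tri_verts_def)
  then show ?thesis by (metis countable_image countableI_type)
qed

lemma drift_law_exists:
  assumes x: "x \<in> \<T>"
  shows "\<exists>\<mu>. markov_law \<T> (drift_kernel \<Phi>) x \<mu>"
proof -
  define f where "f v i = (if i < 3 then exp (tri_alpha \<Phi> i v) / tri_a \<Phi> v else 0)" for v and i :: nat
  define q where "q v = embed_pmf (f v)" for v
  have a_pos: "tri_a \<Phi> v > 0" for v
    by (auto simp: tri_a_def lessThan_empty_iff intro!: sum_pos)
  have sum1: "(\<integral>\<^sup>+i. ennreal (f v i) \<partial>count_space UNIV) = 1" for v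
  proof -
    have "(\<integral>\<^sup>+i. ennreal (f v i) \<partial>count_space UNIV) = (\<Sum>i<3. ennreal (f v i))"
      by (rule nn_integral_count_space'[of "{..<3}"]) (auto simp: f_def)
    also have "\<dots> = ennreal (\<Sum>i<3. f v i)"
      using a_pos[of v] by (intro sum_ennreal) (auto simp: f_def)
    also have "(\<Sum>i<3. f v i) = (\<Sum>i<3. exp (tri_alpha \<Phi> i v)) / tri_a \<Phi> v"
      unfolding sum_divide_distrib by (rule sum.cong) (auto simp: f_def)
    also have "\<dots> = 1" using a_pos[of v] by (simp flip: tri_a_def)
    finally show ?thesis by simp
  qed
  have pmf_q: "pmf (q v) i = f v i" for v i
    unfolding q_def by (rule pmf_embed_pmf) (use a_pos[of v] sum1 in \<open>auto simp: f_def\<close>)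
  have set_q: "set_pmf (q v) \<subseteq> {..<3}" for v
    by (auto simp: set_pmf_iff pmf_q f_def split: if_splits)
  define K where "K v = (if v \<in> \<T> then map_pmf (\<lambda>i. v + \<tau> ^ i) (q v) else return_pmf x)" for v
  have "\<exists>\<mu>. markov_law \<T> (\<lambda>v w. pmf (K v) w) x \<mu>"
  proof (rule markov_law_exists_pmf[OF countable_tri_verts x])
    show "set_pmf (K v) \<subseteq> \<T>" for v
      using set_q[of v] x tri_verts_step[of v] by (auto simp: K_def)
  qed
  moreover have K_eq: "pmf (K v) w = drift_kernel \<Phi> v w" if "v \<in> \<T>" for v w
  proof -
    have "pmf (K v) w = measure (q v) ((\<lambda>i. v + \<tau> ^ i) -` {w})"
      using that by (simp add: K_def pmf_map)
    also have "\<dots> = measure (q v) {i. i < 3 \<and> w = v + \<tau> ^ i}"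
      by (rule measure_pmf.finite_measure_eq_AE) (use set_q[of v] in \<open>auto simp: AE_measure_pmf_iff\<close>)
    also have "\<dots> = (\<Sum>i | i < 3 \<and> w = v + \<tau> ^ i. f v i)"
      by (subst measure_measure_pmf_finite) (auto simp: pmf_q)
    also have "\<dots> = drift_kernel \<Phi> v w"
      unfolding drift_kernel_def
      by (rule sum.mono_neutral_cong_left) (auto simp: f_def)
    finally show ?thesis .
  qed
  ultimately obtain \<mu> where \<mu>: "markov_law \<T> (\<lambda>v w. pmf (K v) w) x \<mu>" by blast
  have "markov_law \<T> (drift_kernel \<Phi>) x \<mu>"
    unfolding markov_law_def
  proof (intro conjI allI ballI impI)
    fix n y z
    assume z: "z \<in> \<T>" and pos: "\<P>(X in \<mu>. \<forall>s\<le>n. X s = y s) > 0"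
    have "{X \<in> space \<mu>. \<forall>s\<le>n. X s = y s} \<noteq> {}"
      using pos by (metis measure_empty less_irrefl)
    then obtain X where X: "X \<in> space \<mu>" and "X n = y n" by blast
    have "sets \<mu> = sets (\<Pi>\<^sub>M n\<in>(UNIV::nat set). count_space \<T>)"
      using \<mu> by (simp add: markov_law_def)
    from sets_eq_imp_space_eq[OF this] have "X n \<in> \<T>"
      using X by (simp add: space_PiM PiE_iff)
    with \<open>X n = y n\<close> have "y n \<in> \<T>" by simp
    then show "\<P>(X in \<mu>. X (Suc n) = z \<bar> \<forall>s\<le>n. X s = y s) = drift_kernel \<Phi> (y n) z"
      using \<mu> z pos by (simp add: markov_law_def K_eq)
  qed (use \<mu> in \<open>simp_all add: markov_law_def\<close>)
  then show ?thesis ..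
qed

lemma srw_law_exists:
  assumes "x \<in> \<T>"
  shows "\<exists>\<mu>. markov_law \<T> srw_kernel x \<mu>"
proof -
  have "drift_kernel (\<lambda>_. 0) = srw_kernel"
    unfolding fun_eq_iff drift_kernel_def srw_kernel_def
    by (intro allI sum.cong) (simp_all add: tri_a_def tri_alpha_def)
  with drift_law_exists[OF assms, of "\<lambda>_. 0"] show ?thesis by simp
qed

end

theory Submission
  imports Defs
begin

text \<open>
  Path probabilities factor into transition probabilities, and taking logarithms in the definition
  of \<open>\<beta>\<close> gives \<open>ln (a(v) / 3) = \<Delta>\<Phi>(v) + \<beta>(v)\<^sup>2 / 3\<close>. Hence each
  step contributes the factor \<open>3 e\<^bsup>\<alpha>\<^esup> / a = exp (\<alpha> - \<Delta>\<Phi> - \<beta>\<^sup>2 / 3)\<close>, and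
  the increments \<open>\<alpha>\<close> of \<open>\<Phi>\<close> telescope along the path.
\<close>

text \<open>The Markov property in \<open>markov_law\<close> speaks only about histories of positive
  probability. Positive steps make the product formula for every prefix positive, so the induction
  may always condition on the prefix and multiply out.\<close>

lemma markov_law_path_prob:
  assumes law: "markov_law S p x \<mu>"
    and start: "\<gamma> 0 = x"
    and steps: "\<And>s. s < n \<Longrightarrow> \<gamma> (Suc s) \<in> S \<and> p (\<gamma> s) (\<gamma> (Suc s)) > 0"
  shows "path_prob \<mu> n \<gamma> = (\<Prod>s<n. p (\<gamma> s) (\<gamma> (Suc s)))"
  using steps
proof (induction n)
  case 0
  then show ?case using law start by (simp add: path_prob_def markov_law_def)
next
  case (Suc n)
  have IH: "path_prob \<mu> n \<gamma> = (\<Prod>s<n. p (\<gamma> s) (\<gamma> (Suc s)))"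
    using Suc by simp
  also have "\<dots> > 0"
    using Suc.prems by (intro prod_pos) simp
  finally have pos: "path_prob \<mu> n \<gamma> > 0" .
  \<comment> \<open>The numerator of the conditional probability is the event of the path extended
    by one step.\<close>
  have "{X \<in> space \<mu>. X (Suc n) = \<gamma> (Suc n) \<and> (\<forall>s\<le>n. X s = \<gamma> s)} =
      {X \<in> space \<mu>. \<forall>s\<le>Suc n. X s = \<gamma> s}"
    by (auto simp: le_Suc_eq)
  moreover have "\<P>(X in \<mu>. X (Suc n) = \<gamma> (Suc n) \<bar> \<forall>s\<le>n. X s = \<gamma> s) = p (\<gamma> n) (\<gamma> (Suc n))"
    using law pos Suc.prems[of n] by (simp add: markov_law_def path_prob_def)
  ultimately have "path_prob \<mu> (Suc n) \<gamma> / path_prob \<mu> n \<gamma> = p (\<gamma> n) (\<gamma> (Suc n))"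
    by (simp add: cond_prob_def path_prob_def)
  then have "path_prob \<mu> (Suc n) \<gamma> = path_prob \<mu> n \<gamma> * p (\<gamma> n) (\<gamma> (Suc n))"
    using pos by (simp add: divide_eq_eq mult.commute)
  then show ?case by (simp add: IH)
qed

lemma tau_eq_cartesian: "\<tau> = Complex (- 1 / 2) (sqrt 3 / 2)"
  by (simp add: tau_def complex_eq_iff Re_exp Im_exp cos_120 sin_120)

text \<open>The imaginary parts 0, \<open>sqrt 3 / 2\<close> and \<open>- sqrt 3 / 2\<close> tell
  the three steps apart. Hence the target of an edge determines its index, and only one summand of
  either kernel survives there.\<close>

lemma tau_power_inj: "inj_on (\<lambda>i. \<tau> ^ i) {..<3::nat}"
proof -
  have "Im (\<tau> ^ 0) = 0" "Im (\<tau> ^ 1) = sqrt 3 / 2" "Im (\<tau> ^ 2) = - sqrt 3 / 2"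
    unfolding tau_sq by (simp_all add: tau_eq_cartesian)
  then show ?thesis
    by (auto simp: inj_on_def numeral_3_eq_3 numeral_2_eq_2 less_Suc_eq simp del: power_Suc)
qed

lemma sum_tau_step:
  fixes f :: "nat \<Rightarrow> real"
  assumes "k < 3"
  shows "(\<Sum>i<3. if v + \<tau> ^ k = v + \<tau> ^ i then f i else 0) = f k"
proof -
  have "(\<Sum>i<3. if v + \<tau> ^ k = v + \<tau> ^ i then f i else 0) = (\<Sum>i<3. if k = i then f i else 0)"
    using assms inj_onD[OF tau_power_inj] by (intro sum.cong) auto
  then show ?thesis using assms by simp
qed

lemma drift_kernel_step:
  "k < 3 \<Longrightarrow> drift_kernel \<Phi> v (v + \<tau> ^ k) = exp (tri_alpha \<Phi> k v) / tri_a \<Phi> v"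
  unfolding drift_kernel_def by (rule sum_tau_step)

lemma srw_kernel_step: "k < 3 \<Longrightarrow> srw_kernel v (v + \<tau> ^ k) = 1 / 3"
  unfolding srw_kernel_def by (rule sum_tau_step)

lemma tri_a_pos: "tri_a \<Phi> v > 0"
  by (simp add: tri_a_def numeral_3_eq_3 add_pos_pos)

lemma sum_tri_alpha: "(\<Sum>i<3. tri_alpha \<Phi> i v) = 3 * tri_laplace \<Phi> v"
  by (simp add: tri_alpha_def tri_laplace_def)

text \<open>Jensen's inequality for \<open>exp\<close> with weights 1/3, that is, AM-GM for the
  three numbers \<open>exp (tri_alpha \<Phi> i v)\<close>.\<close>

lemma tri_laplace_le_ln: "tri_laplace \<Phi> v \<le> ln (tri_a \<Phi> v / 3)"
proof -
  have "exp (\<Sum>i<3. (1 / 3) *\<^sub>R tri_alpha \<Phi> i v) \<le> (\<Sum>i<3. 1 / 3 * exp (tri_alpha \<Phi> i v))"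
    by (rule convex_on_sum[OF _ _ exp_convex]) (auto simp: lessThan_empty_iff)
  then have "exp (tri_laplace \<Phi> v) \<le> tri_a \<Phi> v / 3"
    by (simp add: tri_a_def sum_tri_alpha flip: sum_distrib_left sum_divide_distrib)
  then show ?thesis
    using tri_a_pos by (simp add: ln_ge_iff)
qed

text \<open>
  By AM-GM the right-hand side is nonnegative, so the definite description
  defining \<open>tri_beta\<close> has a witness.
\<close>
lemma tri_beta_sq: "(tri_beta \<Phi> v)\<^sup>2 = 3 * (ln (tri_a \<Phi> v / 3) - tri_laplace \<Phi> v)"
proof -
  \<comment> \<open>Minus the logarithm of the right-hand side in the equation defining
    \<open>tri_beta\<close>.\<close>
  define c where "c = 3 * (ln (tri_a \<Phi> v / 3) - tri_laplace \<Phi> v)"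
  have c: "c \<ge> 0" using tri_laplace_le_ln by (simp add: c_def)
  have "exp (- c) = exp (ln (tri_a \<Phi> v / 3)) powi (-3) * exp (\<Sum>i<3. tri_alpha \<Phi> i v)"
    unfolding sum_tri_alpha c_def exp_power_int by (simp add: algebra_simps flip: exp_add)
  also have "\<dots> = (tri_a \<Phi> v / 3) powi (-3) * (\<Prod>i<3. exp (tri_alpha \<Phi> i v))"
    using tri_a_pos[of \<Phi> v] by (simp add: exp_sum)
  finally have eq: "(tri_a \<Phi> v / 3) powi (-3) * (\<Prod>i<3. exp (tri_alpha \<Phi> i v)) = exp (- c)" ..
  \<comment> \<open>Injectivity of \<open>exp\<close> turns the defining equation into
    \<open>b\<^sup>2 = c\<close>, whose only nonnegative solution is \<open>sqrt c\<close>.\<close>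
  have "tri_beta \<Phi> v = sqrt c"
    unfolding tri_beta_def eq
    by (rule the_equality) (use c in \<open>auto simp: real_sqrt_unique\<close>)
  then show ?thesis using c by (simp add: c_def)
qed

text \<open>One-step likelihood ratio. Membership and positivity are what
  \<open>markov_law_path_prob\<close> demands of each step, under either law.\<close>

lemma drift_srw_kernel_ratio:
  assumes "tri_edge v w"
  shows "w \<in> \<T>" and "drift_kernel \<Phi> v w > 0" and "srw_kernel v w > 0"
    and "drift_kernel \<Phi> v w / srw_kernel v w =
      exp (\<Phi> w - \<Phi> v - (tri_laplace \<Phi> v + 1 / 3 * (tri_beta \<Phi> v)\<^sup>2))"
proof -
  obtain k where k: "k < 3" and w: "w = v + \<tau> ^ k"
    using assms by (auto simp: tri_edge_def)
  show "w \<in> \<T>" using assms by (simp add: tri_edge_def)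
  show "drift_kernel \<Phi> v w > 0" "srw_kernel v w > 0"
    using k tri_a_pos by (simp_all add: w drift_kernel_step srw_kernel_step)
  have "drift_kernel \<Phi> v w / srw_kernel v w = exp (tri_alpha \<Phi> k v) / (tri_a \<Phi> v / 3)"
    using k by (simp add: w drift_kernel_step srw_kernel_step)
  also have "\<dots> = exp (tri_alpha \<Phi> k v - ln (tri_a \<Phi> v / 3))"
    using tri_a_pos[of \<Phi> v] by (simp add: exp_diff)
  \<comment> \<open>By \<open>tri_beta_sq\<close>, the logarithm of the normalisation splits into
    the Laplacian and the \<beta> term, neither depending on the direction \<open>k\<close>.\<close>
  also have "tri_alpha \<Phi> k v - ln (tri_a \<Phi> v / 3) =
      \<Phi> w - \<Phi> v - (tri_laplace \<Phi> v + 1 / 3 * (tri_beta \<Phi> v)\<^sup>2)"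
    by (simp add: tri_beta_sq tri_alpha_def w field_simps)
  finally show "drift_kernel \<Phi> v w / srw_kernel v w =
      exp (\<Phi> w - \<Phi> v - (tri_laplace \<Phi> v + 1 / 3 * (tri_beta \<Phi> v)\<^sup>2))" .
qed

theorem corollary1p4:
  fixes \<Phi> :: "complex \<Rightarrow> real" and x :: complex and n :: nat and \<gamma> :: "nat \<Rightarrow> complex"
    and \<QQ> \<PP> :: "(nat \<Rightarrow> complex) measure"
  assumes "x \<in> \<T>"
    and "markov_law \<T> (drift_kernel \<Phi>) x \<QQ>"
    and "markov_law \<T> srw_kernel x \<PP>"
    and "\<gamma> 0 = x"
    and "\<forall>s<n. tri_edge (\<gamma> s) (\<gamma> (Suc s))"
  shows "(\<forall>v\<in>\<T>. 2 / 3 * (\<Sum>i<3. of_real (tri_alpha \<Phi> i v) * \<tau> ^ i) = tri_grad \<Phi> v) \<and>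
    path_prob \<QQ> n \<gamma> / path_prob \<PP> n \<gamma> =
      exp (\<Phi> (\<gamma> n) - \<Phi> (\<gamma> 0) - (\<Sum>s<n. tri_laplace \<Phi> (\<gamma> s) + 1 / 3 * (tri_beta \<Phi> (\<gamma> s))\<^sup>2))"
proof
  show "\<forall>v\<in>\<T>. 2 / 3 * (\<Sum>i<3. of_real (tri_alpha \<Phi> i v) * \<tau> ^ i) = tri_grad \<Phi> v"
    by (simp add: tri_alpha_def tri_grad_def)
  define A where "A s = tri_laplace \<Phi> (\<gamma> s) + 1 / 3 * (tri_beta \<Phi> (\<gamma> s))\<^sup>2" for s
  have edge: "tri_edge (\<gamma> s) (\<gamma> (Suc s))" if "s < n" for s
    using assms(5) that by simp
  have "path_prob \<QQ> n \<gamma> = (\<Prod>s<n. drift_kernel \<Phi> (\<gamma> s) (\<gamma> (Suc s)))"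
    by (rule markov_law_path_prob[where \<gamma> = \<gamma>, OF assms(2,4)]) (blast dest: edge drift_srw_kernel_ratio)
  moreover have "path_prob \<PP> n \<gamma> = (\<Prod>s<n. srw_kernel (\<gamma> s) (\<gamma> (Suc s)))"
    by (rule markov_law_path_prob[where \<gamma> = \<gamma>, OF assms(3,4)]) (blast dest: edge drift_srw_kernel_ratio)
  ultimately have "path_prob \<QQ> n \<gamma> / path_prob \<PP> n \<gamma> =
      (\<Prod>s<n. drift_kernel \<Phi> (\<gamma> s) (\<gamma> (Suc s)) / srw_kernel (\<gamma> s) (\<gamma> (Suc s)))"
    by (simp add: prod_dividef)
  also have "\<dots> = (\<Prod>s<n. exp (\<Phi> (\<gamma> (Suc s)) - \<Phi> (\<gamma> s) - A s))"
    unfolding A_def by (intro prod.cong refl drift_srw_kernel_ratio edge) simp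
  also have "\<dots> = exp (\<Sum>s<n. \<Phi> (\<gamma> (Suc s)) - \<Phi> (\<gamma> s) - A s)"
    by (simp add: exp_sum)
  \<comment> \<open>Only the increments of \<Phi> telescope; the terms \<open>A s\<close> accumulate
    along the path.\<close>
  also have "(\<Sum>s<n. \<Phi> (\<gamma> (Suc s)) - \<Phi> (\<gamma> s) - A s) = \<Phi> (\<gamma> n) - \<Phi> (\<gamma> 0) - (\<Sum>s<n. A s)"
    using sum_lessThan_telescope[of "\<lambda>s. \<Phi> (\<gamma> s)" n] by (simp add: sum_subtractf)
  finally show "path_prob \<QQ> n \<gamma> / path_prob \<PP> n \<gamma> =
      exp (\<Phi> (\<gamma> n) - \<Phi> (\<gamma> 0) - (\<Sum>s<n. tri_laplace \<Phi> (\<gamma> s) + 1 / 3 * (tri_beta \<Phi> (\<gamma> s))\<^sup>2))"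
    by (simp only: A_def)
qed

end
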